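(* Let $(G,\sigma)$ and $(H,\sigma')$ be finite simple graphs with linear orderings of their vertex sets, and let $\tau$ be any quasi-lexicographic ordering of $V(G\Box H)$ (with respect to $\sigma,\sigma'$). Let $\mathcal{C}$ be the coloring obtained by the First-Fit coloring of $(G\Box H,\mathrm{lex})$ and $\mathcal{C}'$ the coloring obtained by the First-Fit coloring of $(G\Box H,\tau)$. Then $\mathcal{C}=\mathcal{C}'$, and $FF(G\Box H,\mathrm{lex})=FF(G\Box H,\tau)$.
   Context: $G\Box H$ is the Cartesian product: vertex set $V(G)\times V(H)$, with $(u,v)\sim(u',v')$ iff either $u=u'$ and $vv'\in E(H)$, or $uu'\in E(G)$ and $v=v'$. The First-Fit coloring of a graph with a vertex ordering scans vertices in that order and gives each vertex the smallest positive integer not used on its previously colored neighbors; $FF(\cdot,\cdot)$ denotes the number of colors it uses. The lexicographic ordering $\mathrm{lex}$ of $V(G\Box H)$ induced by $\sigma,\sigma'$: $(u,v)$ precedes $(u',v')$ iff $\sigma(u)<\sigma(u')$, or $u=u'$ and $\sigma'(v)<\sigma'(v')$ (i.e. scanning the $|V(G)|\times|V(H)|$ array row by row, left to right). An ordering $\tau$ of $V(G\Box H)$ is quasi-lexicographic if for all vertices $(u,v),(u',v')$, $\tau(u,v)<\tau(u',v')$ implies $\sigma(u)<\sigma(u')$ or $\sigma'(v)<\sigma'(v')$. *)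

theory Defs
  imports "Graph_Theory.Pair_Digraph"
begin

text \<open>
  Finite simple graphs are the \<open>pair_graph\<close>s of the library: finite, symmetric, loop-free
  digraphs whose arcs are pairs of vertices, so that an edge \<open>uv\<close> is the pair of
  arcs \<open>(u, v)\<close> and \<open>(v, u)\<close>.
\<close>

definition cartesian_product ::
  "'a pair_pre_digraph \<Rightarrow> 'b pair_pre_digraph \<Rightarrow> ('a \<times> 'b) pair_pre_digraph"
  (infixr "\<box>" 80) where
  "G \<box> H = \<lparr> pverts = pverts G \<times> pverts H,
     parcs = {((u, v), (u', v')) | u v u' v'.
       (u = u' \<and> u \<in> pverts G \<and> (v, v') \<in> parcs H) \<or>
       ((u, u') \<in> parcs G \<and> v = v' \<and> v \<in> pverts H)} \<rparr>"

lemma pair_graph_cartesian_product: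
  assumes "pair_graph G" "pair_graph H"
  shows "pair_graph (G \<box> H)"
proof -
  interpret G: pair_graph G by fact
  interpret H: pair_graph H by fact
  have sub: "parcs (G \<box> H) \<subseteq> pverts (G \<box> H) \<times> pverts (G \<box> H)"
    by (auto simp: cartesian_product_def dest: G.wellformed' H.wellformed')
  have fin: "finite (pverts (G \<box> H))"
    by (simp add: cartesian_product_def)
  have "finite (parcs (G \<box> H))"
    by (rule finite_subset[OF sub]) (simp add: fin)
  moreover have "sym (parcs G)" "sym (parcs H)"
    using G.pair_sym_arcs H.pair_sym_arcs by (simp_all add: symmetric_def)
  then have "symmetric (with_proj (G \<box> H))"
    unfolding symmetric_def with_proj_simps
    by (auto simp: cartesian_product_def sym_def)
  moreover have "fst e \<noteq> snd e" if "e \<in> parcs (G \<box> H)" for e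
    using that G.pair_no_loops H.pair_no_loops by (fastforce simp: cartesian_product_def)
  ultimately show ?thesis
    using sub fin by unfold_locales auto
qed


text \<open>
  A linear ordering of a finite vertex set is represented by the list of the vertices in
  increasing order; \<open>precedes \<sigma> u v\<close> renders \<open>\<sigma>(u) < \<sigma>(v)\<close>.
\<close>

definition vertex_ordering :: "'a pair_pre_digraph \<Rightarrow> 'a list \<Rightarrow> bool" where
  "vertex_ordering G \<sigma> \<longleftrightarrow> distinct \<sigma> \<and> set \<sigma> = pverts G"

definition precedes :: "'a list \<Rightarrow> 'a \<Rightarrow> 'a \<Rightarrow> bool" where
  "precedes \<sigma> u v \<longleftrightarrow> (\<exists>i j. i < j \<and> j < length \<sigma> \<and> \<sigma> ! i = u \<and> \<sigma> ! j = v)"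

text \<open>
  \<open>List.product\<close> enumerates the array row by row; its order relation is the expected one by
  \<open>precedes_lex_ordering\<close> below.
\<close>

definition lex_ordering :: "'a list \<Rightarrow> 'b list \<Rightarrow> ('a \<times> 'b) list" where
  "lex_ordering \<sigma> \<sigma>' = List.product \<sigma> \<sigma>'"

definition quasi_lexicographic ::
  "'a pair_pre_digraph \<Rightarrow> 'a list \<Rightarrow> 'b pair_pre_digraph \<Rightarrow> 'b list \<Rightarrow> ('a \<times> 'b) list \<Rightarrow> bool" where
  "quasi_lexicographic G \<sigma> H \<sigma>' \<tau> \<longleftrightarrow>
     vertex_ordering (G \<box> H) \<tau> \<and>
     (\<forall>u v u' v'. (u, v) \<in> pverts (G \<box> H) \<longrightarrow> (u', v') \<in> pverts (G \<box> H) \<longrightarrow>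
        precedes \<tau> (u, v) (u', v') \<longrightarrow> precedes \<sigma> u u' \<or> precedes \<sigma>' v v')"

lemma precedes_Nil [simp]: "\<not> precedes [] u v"
  by (simp add: precedes_def)

lemma precedes_Cons:
  "precedes (x # xs) u v \<longleftrightarrow> (u = x \<and> v \<in> set xs) \<or> precedes xs u v"
proof
  assume "precedes (x # xs) u v"
  then obtain i j where ij: "i < j" "j < length (x # xs)" "(x # xs) ! i = u" "(x # xs) ! j = v"
    by (auto simp: precedes_def)
  then obtain k where k: "j = Suc k" by (cases j) auto
  show "(u = x \<and> v \<in> set xs) \<or> precedes xs u v"
  proof (cases i)
    case 0
    then show ?thesis using ij k by auto
  next
    case (Suc l)
    then show ?thesis using ij k by (auto simp: precedes_def)
  qed
next
  assume "(u = x \<and> v \<in> set xs) \<or> precedes xs u v"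
  then show "precedes (x # xs) u v"
  proof
    assume *: "u = x \<and> v \<in> set xs"
    then obtain k where "k < length xs" "xs ! k = v" by (auto simp: in_set_conv_nth)
    with * show ?thesis
      unfolding precedes_def by (intro exI[of _ 0] exI[of _ "Suc k"]) simp
  next
    assume "precedes xs u v"
    then obtain i j where "i < j" "j < length xs" "xs ! i = u" "xs ! j = v"
      by (auto simp: precedes_def)
    then show ?thesis
      unfolding precedes_def by (intro exI[of _ "Suc i"] exI[of _ "Suc j"]) simp
  qed
qed

lemma precedes_append:
  "precedes (xs @ ys) u v \<longleftrightarrow>
     precedes xs u v \<or> precedes ys u v \<or> (u \<in> set xs \<and> v \<in> set ys)"
  by (induction xs) (auto simp: precedes_Cons)

lemma precedes_in_set: "precedes xs u v \<Longrightarrow> u \<in> set xs \<and> v \<in> set xs"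
  by (auto simp: precedes_def)

lemma precedes_map_Pair:
  "precedes (map (Pair x) ys) (u, v) (u', v') \<longleftrightarrow> u = x \<and> u' = x \<and> precedes ys v v'"
  by (induction ys) (auto simp: precedes_Cons)

lemma vertex_ordering_lex:
  "vertex_ordering G \<sigma> \<Longrightarrow> vertex_ordering H \<sigma>' \<Longrightarrow>
     vertex_ordering (G \<box> H) (lex_ordering \<sigma> \<sigma>')"
  by (simp add: vertex_ordering_def lex_ordering_def cartesian_product_def distinct_product)

lemma precedes_lex_ordering:
  assumes "u \<in> set \<sigma>" "u' \<in> set \<sigma>" "v \<in> set \<sigma>'" "v' \<in> set \<sigma>'"
  shows "precedes (lex_ordering \<sigma> \<sigma>') (u, v) (u', v') \<longleftrightarrow>
     precedes \<sigma> u u' \<or> (u = u' \<and> precedes \<sigma>' v v')"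
  using assms(1,2)
proof (induction \<sigma>)
  case (Cons x \<sigma>)
  have *: "precedes (lex_ordering \<sigma> \<sigma>') (u, v) (u', v') \<Longrightarrow> u \<in> set \<sigma> \<and> u' \<in> set \<sigma>"
    by (auto simp: lex_ordering_def dest: precedes_in_set)
  have "precedes (lex_ordering (x # \<sigma>) \<sigma>') (u, v) (u', v') \<longleftrightarrow>
      (u = x \<and> u' = x \<and> precedes \<sigma>' v v') \<or>
      precedes (lex_ordering \<sigma> \<sigma>') (u, v) (u', v') \<or> (u = x \<and> u' \<in> set \<sigma>)"
    using assms(3,4) by (auto simp: lex_ordering_def precedes_append precedes_map_Pair)
  then show ?case
    using Cons * by (auto simp: precedes_Cons dest: precedes_in_set)
qed simp


text \<open>
  The state of the scan is the partial colouring of the vertices seen so far; vertices not yet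
  coloured are mapped to \<open>None\<close>.
\<close>

definition ff_step ::
  "'a pair_pre_digraph \<Rightarrow> 'a \<Rightarrow> ('a \<rightharpoonup> nat) \<Rightarrow> ('a \<rightharpoonup> nat)" where
  "ff_step G v c = c(v \<mapsto> (LEAST k. 0 < k \<and> (\<forall>u. (u, v) \<in> parcs G \<longrightarrow> c u \<noteq> Some k)))"

definition first_fit_coloring :: "'a pair_pre_digraph \<Rightarrow> 'a list \<Rightarrow> ('a \<rightharpoonup> nat)" where
  "first_fit_coloring G \<sigma> = fold (ff_step G) \<sigma> Map.empty"

definition FF :: "'a pair_pre_digraph \<Rightarrow> 'a list \<Rightarrow> nat" where
  "FF G \<sigma> = card (ran (first_fit_coloring G \<sigma>))"

end

theory Submission
  imports Defs
begin

text \<open>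
  The colour First-Fit gives to a vertex depends only on the colours of its earlier neighbours, so
  two orderings that agree on adjacent vertices yield the same colouring. Adjacent vertices of
  \<open>G \<box> H\<close> share a coordinate, and for such pairs the disjunction in the quasi-lexicographic
  condition collapses to the lexicographic comparison.
\<close>

lemma precedes_irrefl: "distinct xs \<Longrightarrow> \<not> precedes xs u u"
  by (induction xs) (auto simp: precedes_Cons dest: precedes_in_set)

lemma precedes_asym: "distinct xs \<Longrightarrow> precedes xs u v \<Longrightarrow> \<not> precedes xs v u"
  by (induction xs) (auto simp: precedes_Cons dest: precedes_in_set)

lemma precedes_total:
  "u \<in> set xs \<Longrightarrow> v \<in> set xs \<Longrightarrow> u \<noteq> v \<Longrightarrow> precedes xs u v \<or> precedes xs v u"
  by (induction xs) (auto simp: precedes_Cons)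

lemma first_fit_coloring_snoc:
  "first_fit_coloring G (xs @ [x]) = ff_step G x (first_fit_coloring G xs)"
  by (simp add: first_fit_coloring_def)

lemma first_fit_coloring_eq_None:
  "v \<notin> set xs \<Longrightarrow> first_fit_coloring G xs v = None"
proof (induction xs rule: rev_induct)
  case Nil
  then show ?case by (simp add: first_fit_coloring_def)
next
  case (snoc x xs)
  then show ?case by (simp add: first_fit_coloring_snoc ff_step_def)
qed

text \<open>A colour never changes once assigned, and when \<open>v\<close> is scanned exactly its
  predecessors are coloured. So the intermediate state of the scan can be replaced by the final
  colouring, which leaves a recursion where the ordering enters only through
  \<open>precedes\<close>.\<close>

lemma first_fit_coloring_eq_Least:
  assumes "distinct xs" "v \<in> set xs"
  shows "first_fit_coloring G xs v =
    Some (LEAST k. 0 < k \<and>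
      (\<forall>u. (u, v) \<in> parcs G \<longrightarrow> precedes xs u v \<longrightarrow> first_fit_coloring G xs u \<noteq> Some k))"
  using assms
proof (induction xs rule: rev_induct)
  case Nil
  then show ?case by simp
next
  case (snoc x xs)
  let ?c = "first_fit_coloring G xs" and ?d = "first_fit_coloring G (xs @ [x])"
  have d: "?d u = ?c u" if "u \<noteq> x" for u
    using that by (simp add: first_fit_coloring_snoc ff_step_def)
  have x: "x \<notin> set xs" using snoc.prems by simp
  show ?case
  proof (cases "v = x")
    case True
    \<comment> \<open>If \<open>u\<close> lies outside \<open>xs\<close>, both sides are true:
      \<open>?c u\<close> is \<open>None\<close>, and \<open>u\<close> does not precede the last
      vertex \<open>v\<close>. Hence restricting to predecessors loses no constraint.\<close>
    have "?c u \<noteq> Some k \<longleftrightarrow> (precedes (xs @ [x]) u v \<longrightarrow> ?d u \<noteq> Some k)" for u k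
    proof (cases "u \<in> set xs")
      case u: True
      then have "u \<noteq> x" using x by auto
      then show ?thesis using u True d[of u] by (auto simp: precedes_append)
    next
      case False
      then show ?thesis
        using True x
        by (auto simp: first_fit_coloring_eq_None precedes_append precedes_Cons dest: precedes_in_set)
    qed
    then have "(\<lambda>k. 0 < k \<and> (\<forall>u. (u, v) \<in> parcs G \<longrightarrow> ?c u \<noteq> Some k)) =
        (\<lambda>k. 0 < k \<and> (\<forall>u. (u, v) \<in> parcs G \<longrightarrow> precedes (xs @ [x]) u v \<longrightarrow> ?d u \<noteq> Some k))"
      by blast
    moreover have "?d v = Some (LEAST k. 0 < k \<and> (\<forall>u. (u, v) \<in> parcs G \<longrightarrow> ?c u \<noteq> Some k))"
      unfolding first_fit_coloring_snoc ff_step_def using True by simp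
    ultimately show ?thesis by argo
  next
    case False
    \<comment> \<open>An older vertex \<open>v\<close> keeps its predecessors when \<open>x\<close>
      is appended, and none of them is \<open>x\<close>, so their colours are unaffected.\<close>
    have p: "precedes (xs @ [x]) u v \<longleftrightarrow> precedes xs u v" for u
      using False by (auto simp: precedes_append precedes_Cons)
    have "?d u = ?c u" if "precedes xs u v" for u
      using that x by (intro d) (auto dest: precedes_in_set)
    then have "(precedes (xs @ [x]) u v \<longrightarrow> ?d u \<noteq> Some k) \<longleftrightarrow>
        (precedes xs u v \<longrightarrow> ?c u \<noteq> Some k)" for u k
      by (auto simp: p)
    then have "(\<lambda>k. 0 < k \<and> (\<forall>u. (u, v) \<in> parcs G \<longrightarrow> precedes xs u v \<longrightarrow> ?c u \<noteq> Some k)) =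
        (\<lambda>k. 0 < k \<and> (\<forall>u. (u, v) \<in> parcs G \<longrightarrow> precedes (xs @ [x]) u v \<longrightarrow> ?d u \<noteq> Some k))"
      by blast
    moreover have "?d v = Some (LEAST k. 0 < k \<and>
        (\<forall>u. (u, v) \<in> parcs G \<longrightarrow> precedes xs u v \<longrightarrow> ?c u \<noteq> Some k))"
      unfolding d[OF False] by (rule snoc.IH) (use snoc.prems False in auto)
    ultimately show ?thesis by argo
  qed
qed

text \<open>Strong induction on the position in \<open>xs\<close>: at each vertex both recursions
  minimise over the same earlier neighbours, whose colours agree by induction.\<close>

lemma first_fit_coloring_cong:
  assumes "distinct xs" "distinct ys" "set xs = set ys"
    and agree: "\<And>u v. (u, v) \<in> parcs G \<Longrightarrow> precedes xs u v \<longleftrightarrow> precedes ys u v"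
  shows "first_fit_coloring G xs = first_fit_coloring G ys"
proof
  fix v
  have on_nth: "first_fit_coloring G xs (xs ! i) = first_fit_coloring G ys (xs ! i)"
    if "i < length xs" for i
    using that
  proof (induction i rule: less_induct)
    case (less i)
    let ?v = "xs ! i"
    have earlier: "first_fit_coloring G xs u = first_fit_coloring G ys u" if "precedes xs u ?v" for u
    proof -
      from that obtain j k where jk: "j < k" "k < length xs" "xs ! j = u" "xs ! k = ?v"
        by (auto simp: precedes_def)
      \<comment> \<open>Distinctness makes the position of \<open>?v\<close> unique, so
        \<open>u\<close> sits at a position below \<open>i\<close>.\<close>
      then have "k = i" using less.prems assms(1) by (simp add: nth_eq_iff_index_eq)
      then show ?thesis using less.IH[of j] jk by simp
    qed
    have least: "(\<lambda>k. 0 < k \<and>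
          (\<forall>u. (u, ?v) \<in> parcs G \<longrightarrow> precedes xs u ?v \<longrightarrow> first_fit_coloring G xs u \<noteq> Some k)) =
        (\<lambda>k. 0 < k \<and>
          (\<forall>u. (u, ?v) \<in> parcs G \<longrightarrow> precedes ys u ?v \<longrightarrow> first_fit_coloring G ys u \<noteq> Some k))"
      \<comment> \<open>\<open>imp_cong\<close> makes first the arc and then the precedence
        available as assumptions: \<open>agree\<close> needs the former, \<open>earlier\<close> the
        latter.\<close>
      by (intro ext arg_cong2[where f = "(\<and>)"] refl all_cong1 imp_cong agree)
        (simp_all only: agree[symmetric] earlier)
    have v: "?v \<in> set xs" "?v \<in> set ys"
      using nth_mem[OF less.prems] unfolding assms(3) by assumption+
    show ?case
      by (rule trans[OF first_fit_coloring_eq_Least[OF assms(1) v(1)]],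
          subst first_fit_coloring_eq_Least[OF assms(2) v(2)], subst least, rule refl)
  qed
  show "first_fit_coloring G xs v = first_fit_coloring G ys v"
  proof (cases "v \<in> set xs")
    case True
    then show ?thesis using on_nth by (auto simp: in_set_conv_nth)
  next
    case False
    then show ?thesis using assms(3) by (simp add: first_fit_coloring_eq_None)
  qed
qed

text \<open>One implication suffices. Adjacent vertices are distinct, so if \<open>u\<close> does
  not precede \<open>v\<close> in \<open>ys\<close>, then \<open>v\<close> precedes
  \<open>u\<close>; applying \<open>imp\<close> to the reverse arc and asymmetry in
  \<open>xs\<close> gives the converse.\<close>

lemma (in pair_graph) first_fit_coloring_eqI:
  assumes xs: "vertex_ordering G xs" and ys: "vertex_ordering G ys"
    and imp: "\<And>u v. (u, v) \<in> parcs G \<Longrightarrow> precedes ys u v \<Longrightarrow> precedes xs u v"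
  shows "first_fit_coloring G xs = first_fit_coloring G ys"
proof (rule first_fit_coloring_cong)
  show "distinct xs" "distinct ys" "set xs = set ys"
    using xs ys by (auto simp: vertex_ordering_def)
  fix u v assume arc: "(u, v) \<in> parcs G"
  have rev: "(v, u) \<in> parcs G"
    using pair_sym_arcs arc by (auto simp: symmetric_def dest: symD)
  have "u \<in> set ys" "v \<in> set ys" "u \<noteq> v"
    using arc wellformed'[OF arc] pair_no_loops[OF arc] ys by (auto simp: vertex_ordering_def)
  then have "precedes ys u v \<or> precedes ys v u" by (rule precedes_total)
  then show "precedes xs u v \<longleftrightarrow> precedes ys u v"
    using imp[OF arc] imp[OF rev] precedes_asym[OF \<open>distinct xs\<close>] by blast
qed

theorem theorem2:
  fixes G :: "'a pair_pre_digraph" and H :: "'b pair_pre_digraph"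
    and \<sigma> :: "'a list" and \<sigma>' :: "'b list" and \<tau> :: "('a \<times> 'b) list"
  assumes "pair_graph G" and "vertex_ordering G \<sigma>"
    and "pair_graph H" and "vertex_ordering H \<sigma>'"
    and "quasi_lexicographic G \<sigma> H \<sigma>' \<tau>"
  shows "first_fit_coloring (G \<box> H) (lex_ordering \<sigma> \<sigma>') = first_fit_coloring (G \<box> H) \<tau>
    \<and> FF (G \<box> H) (lex_ordering \<sigma> \<sigma>') = FF (G \<box> H) \<tau>"
proof -
  interpret P: pair_graph "G \<box> H"
    using assms(1,3) by (rule pair_graph_cartesian_product)
  have "first_fit_coloring (G \<box> H) (lex_ordering \<sigma> \<sigma>') = first_fit_coloring (G \<box> H) \<tau>"
  proof (rule P.first_fit_coloring_eqI)
    show "vertex_ordering (G \<box> H) (lex_ordering \<sigma> \<sigma>')"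
      using assms(2,4) by (rule vertex_ordering_lex)
    show "vertex_ordering (G \<box> H) \<tau>"
      using assms(5) by (simp add: quasi_lexicographic_def)
    fix x y assume arc: "(x, y) \<in> parcs (G \<box> H)" and prec: "precedes \<tau> x y"
    obtain u v u' v' where xy: "x = (u, v)" "y = (u', v')" by (cases x, cases y)
    have verts: "(u, v) \<in> pverts (G \<box> H)" "(u', v') \<in> pverts (G \<box> H)"
      using P.wellformed'[OF arc] xy by auto
    then have quasi: "precedes \<sigma> u u' \<or> precedes \<sigma>' v v'"
      using assms(5) prec xy by (auto simp: quasi_lexicographic_def)
    have "u = u' \<or> v = v'"
      using arc xy by (auto simp: cartesian_product_def)
    \<comment> \<open>By irreflexivity, \<open>u = u'\<close> rules out the first disjunct of
      \<open>quasi\<close>, and \<open>v = v'\<close> rules out the second.\<close>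
    then have "precedes \<sigma> u u' \<or> u = u' \<and> precedes \<sigma>' v v'"
      using quasi assms(2,4) by (auto simp: vertex_ordering_def precedes_irrefl)
    moreover have "u \<in> set \<sigma>" "u' \<in> set \<sigma>" "v \<in> set \<sigma>'" "v' \<in> set \<sigma>'"
      using verts assms(2,4) by (auto simp: vertex_ordering_def cartesian_product_def)
    ultimately show "precedes (lex_ordering \<sigma> \<sigma>') x y"
      by (simp add: xy precedes_lex_ordering)
  qed
  then show ?thesis by (simp add: FF_def)
qed

end
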